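(* Let $K$ be a field of characteristic zero, let $n\ge 5$, let $K[x]=K[x_1,\dots,x_n]$ be the polynomial algebra, and let $\sigma$ be the $K$-algebra automorphism of $K[x]$ given by $\sigma(x_1)=x_1-1$ and $\sigma(x_i)=x_i+x_{i-1}$ for $2\le i\le n$. Then, for $k=2,\dots,[(n-1)/2]$, the polynomial $$v_k=x_1u_k+x_kx_{k+1}+\sum_{i=1}^{k-1}\sum_{j=k+1}^{2k-i+1}\alpha_{i,j}^k\,x_ix_j+\sum_{i=k+1}^{2k+1}\beta_i^k\,x_i$$ belongs to $K[x]^\sigma\cap K[x]_{\le 3}$, where $$\alpha_{i,j}^k=(-1)^{k-i}\left\{2\binom{k-i-1}{j-k-1}+3\binom{k-i-1}{j-k-2}+(k-i-1)\left[\binom{k-i}{j-k-1}+\binom{k-i-1}{j-k-2}\right]\right\}$$ (equivalently $\alpha_{i,j}^k=(-1)^{k-i}\{2\binom{k-i-1}{j-k-1}+3\binom{k-i-1}{j-k-2}\}+(k-i-1)\lambda_{i,j-1}^k$) and $$\beta_j^k=\alpha_{1,j-1}^k+\alpha_{1,j}^k+\mu_{j-1}^k,\qquad j=k+1,\dots,2k+1.$$ Moreover, each of the coefficients $\alpha_{i,j}^k$ and $\beta_i^k$ (occurring in the formula for $v_k$) is nonzero.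
   Context: $K[x]^\sigma=\{f:\sigma(f)=f\}$; $K[x]_{\le d}$ is the space of polynomials of total degree at most $d$; $[r]$ is the floor of $r$. Convention: $\binom{a}{b}=0$ for integers $a,b$ not satisfying $0\le b\le a$ (so in particular the formula for $\alpha^k_{i,j}$ gives $\alpha_{1,k}^k=\alpha_{1,2k+1}^k=0$). The polynomials $u_k$ are $$u_k=x_k^2+\sum_{i=1}^{k-1}\sum_{j=k}^{2k-i}\lambda_{i,j}^k x_ix_j+\sum_{i=k}^{2k}\mu_i^kx_i,$$ with $\lambda_{i,j}^k=(-1)^{k-i}\{\binom{k-i}{j-k}+\binom{k-i-1}{j-k-1}\}$ and $\mu_i^k=(-1)^{k-1}\{\binom{k}{i-k}+\binom{k-1}{i-k-1}\}$. *)

theory Defs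
  imports Complex_Main "HOL-Library.Poly_Mapping"
begin

text \<open>
  Multivariate polynomials are finitely supported maps from monomials to coefficients, where a
  monomial is a finitely supported map from variable indices to exponents; the ring operations are
  those of \<^theory>\<open>HOL-Library.Poly_Mapping\<close>. The type has variables indexed by all natural numbers;
  the polynomial algebra in $x_1, \dots, x_n$ is its subring \<open>poly_ring n\<close>.
\<close>

type_synonym 'k mpoly = "(nat \<Rightarrow>\<^sub>0 nat) \<Rightarrow>\<^sub>0 'k"

definition Const :: "'k \<Rightarrow> 'k::zero mpoly" where
  "Const c = Poly_Mapping.single 0 c"

definition Var :: "nat \<Rightarrow> 'k::zero_neq_one mpoly" where
  "Var i = Poly_Mapping.single (Poly_Mapping.single i 1) 1"

definition poly_ring :: "nat \<Rightarrow> 'k::zero mpoly set" where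
  "poly_ring n = {p. \<forall>m \<in> Poly_Mapping.keys p. Poly_Mapping.keys m \<subseteq> {1..n}}"

definition mon_degree :: "(nat \<Rightarrow>\<^sub>0 nat) \<Rightarrow> nat" where
  "mon_degree m = (\<Sum>i \<in> Poly_Mapping.keys m. Poly_Mapping.lookup m i)"

definition polys_le :: "nat \<Rightarrow> nat \<Rightarrow> 'k::zero mpoly set" where
  "polys_le n d = {p \<in> poly_ring n. \<forall>m \<in> Poly_Mapping.keys p. mon_degree m \<le> d}"

text \<open>
  An automorphism of \<open>poly_ring n\<close> is represented by a function on the whole type, whose values
  outside \<open>poly_ring n\<close> are irrelevant.
\<close>

definition alg_automorphism :: "nat \<Rightarrow> ('k::comm_ring_1 mpoly \<Rightarrow> 'k mpoly) \<Rightarrow> bool" where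
  "alg_automorphism n \<sigma> \<longleftrightarrow>
     bij_betw \<sigma> (poly_ring n) (poly_ring n) \<and>
     (\<forall>p \<in> poly_ring n. \<forall>q \<in> poly_ring n. \<sigma> (p + q) = \<sigma> p + \<sigma> q) \<and>
     (\<forall>p \<in> poly_ring n. \<forall>q \<in> poly_ring n. \<sigma> (p * q) = \<sigma> p * \<sigma> q) \<and>
     (\<forall>c. \<sigma> (Const c) = Const c)"

definition fixed_ring :: "nat \<Rightarrow> ('k::zero mpoly \<Rightarrow> 'k mpoly) \<Rightarrow> 'k mpoly set" where
  "fixed_ring n \<sigma> = {p \<in> poly_ring n. \<sigma> p = p}"

definition binom :: "int \<Rightarrow> int \<Rightarrow> int" where
  "binom a b = (if 0 \<le> b \<and> b \<le> a then int (nat a choose nat b) else 0)"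

text \<open>
  The coefficients are integers, mapped to the field by \<^const>\<open>of_int\<close>. Indices are natural numbers,
  converted to integers where differences may be negative; the exponents of $-1$ are never negative,
  since $i \le k$ wherever these coefficients occur.
\<close>

definition lam :: "nat \<Rightarrow> nat \<Rightarrow> nat \<Rightarrow> int" where
  "lam k i j = (-1) ^ (k - i) *
     (binom (int k - int i) (int j - int k) + binom (int k - int i - 1) (int j - int k - 1))"

definition mu :: "nat \<Rightarrow> nat \<Rightarrow> int" where
  "mu k i = (-1) ^ (k - 1) *
     (binom (int k) (int i - int k) + binom (int k - 1) (int i - int k - 1))"

definition alpha :: "nat \<Rightarrow> nat \<Rightarrow> nat \<Rightarrow> int" where
  "alpha k i j = (-1) ^ (k - i) *
     (2 * binom (int k - int i - 1) (int j - int k - 1)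
      + 3 * binom (int k - int i - 1) (int j - int k - 2)
      + (int k - int i - 1) *
          (binom (int k - int i) (int j - int k - 1) + binom (int k - int i - 1) (int j - int k - 2)))"

definition beta :: "nat \<Rightarrow> nat \<Rightarrow> int" where
  "beta k j = alpha k 1 (j - 1) + alpha k 1 j + mu k (j - 1)"

definition u :: "nat \<Rightarrow> 'k::comm_ring_1 mpoly" where
  "u k = Var k ^ 2
     + (\<Sum>i = 1..k - 1. \<Sum>j = k..2 * k - i. Const (of_int (lam k i j)) * Var i * Var j)
     + (\<Sum>i = k..2 * k. Const (of_int (mu k i)) * Var i)"

definition v :: "nat \<Rightarrow> 'k::comm_ring_1 mpoly" where
  "v k = Var 1 * u k + Var k * Var (k + 1)
     + (\<Sum>i = 1..k - 1. \<Sum>j = k + 1..2 * k - i + 1. Const (of_int (alpha k i j)) * Var i * Var j)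
     + (\<Sum>i = k + 1..2 * k + 1. Const (of_int (beta k i)) * Var i)"


text \<open>
  Existence of the automorphism with $x_1 \mapsto x_1 - 1$ and $x_i \mapsto x_i + x_{i-1}$, obtained
  by substitution.
\<close>

definition mon_subst :: "(nat \<Rightarrow> 'k::comm_ring_1 mpoly) \<Rightarrow> (nat \<Rightarrow>\<^sub>0 nat) \<Rightarrow> 'k mpoly" where
  "mon_subst f m = (\<Prod>i \<in> Poly_Mapping.keys m. f i ^ Poly_Mapping.lookup m i)"

definition poly_subst :: "(nat \<Rightarrow> 'k::comm_ring_1 mpoly) \<Rightarrow> 'k mpoly \<Rightarrow> 'k mpoly" where
  "poly_subst f p =
     (\<Sum>m \<in> Poly_Mapping.keys p. Const (Poly_Mapping.lookup p m) * mon_subst f m)"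

lemma Const_add: "Const (a + b) = Const a + Const b"
  by (simp add: Const_def single_add)

lemma Const_mult: "Const (a * b) = Const a * (Const b :: 'k::comm_ring_1 mpoly)"
  by (simp add: Const_def mult_single)

lemma Const_0 [simp]: "Const 0 = 0"
  by (simp add: Const_def)

lemma Const_1 [simp]: "Const (1 :: 'k::comm_ring_1) = 1"
  by (simp add: Const_def)

lemma poly_decomp:
  fixes p :: "'a \<Rightarrow>\<^sub>0 'b::comm_monoid_add"
  shows "p = (\<Sum>m \<in> Poly_Mapping.keys p. Poly_Mapping.single m (Poly_Mapping.lookup p m))"
proof (rule poly_mapping_eqI)
  fix k
  show "Poly_Mapping.lookup p k = Poly_Mapping.lookup
    (\<Sum>m \<in> Poly_Mapping.keys p. Poly_Mapping.single m (Poly_Mapping.lookup p m)) k"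
    by (auto simp: lookup_sum lookup_single when_def in_keys_iff)
qed

lemma poly_sum_induct [case_names zero single add]:
  fixes p :: "'a \<Rightarrow>\<^sub>0 'b::comm_monoid_add"
  assumes "P 0" "\<And>m c. P (Poly_Mapping.single m c)" "\<And>p q. P p \<Longrightarrow> P q \<Longrightarrow> P (p + q)"
  shows "P p"
proof -
  have "P (\<Sum>m \<in> S. Poly_Mapping.single m (Poly_Mapping.lookup p m))" if "finite S" for S
    using that by induction (use assms in auto)
  from this[of "Poly_Mapping.keys p"] show ?thesis
    using poly_decomp[of p] by simp
qed

lemma mon_subst_superset:
  assumes "finite S" "Poly_Mapping.keys m \<subseteq> S"
  shows "mon_subst f m = (\<Prod>i \<in> S. f i ^ Poly_Mapping.lookup m i)"
  unfolding mon_subst_def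
  by (rule prod.mono_neutral_left) (use assms in \<open>auto simp: in_keys_iff\<close>)

lemma poly_subst_superset:
  assumes "finite S" "Poly_Mapping.keys p \<subseteq> S"
  shows "poly_subst f p = (\<Sum>m \<in> S. Const (Poly_Mapping.lookup p m) * mon_subst f m)"
  unfolding poly_subst_def
  by (rule sum.mono_neutral_left) (use assms in \<open>auto simp: in_keys_iff\<close>)

lemma mon_subst_add: "mon_subst f (m + m') = mon_subst f m * mon_subst f m'"
proof -
  let ?S = "Poly_Mapping.keys m \<union> Poly_Mapping.keys m'"
  have "Poly_Mapping.keys (m + m') \<subseteq> ?S"
    by (rule keys_add)
  then show ?thesis
    by (subst (1 2 3) mon_subst_superset[of ?S])
       (auto simp: lookup_add power_add prod.distrib)
qed

lemma poly_subst_add: "poly_subst f (p + q) = poly_subst f p + poly_subst f q"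
proof -
  let ?S = "Poly_Mapping.keys p \<union> Poly_Mapping.keys q"
  have "Poly_Mapping.keys (p + q) \<subseteq> ?S"
    by (rule keys_add)
  then show ?thesis
    by (subst (1 2 3) poly_subst_superset[of ?S])
       (auto simp: lookup_add Const_add distrib_right sum.distrib)
qed

lemma poly_subst_0 [simp]: "poly_subst f 0 = 0"
  by (simp add: poly_subst_def)

lemma poly_subst_single: "poly_subst f (Poly_Mapping.single m c) = Const c * mon_subst f m"
  by (cases "c = 0") (auto simp: poly_subst_def)

lemma poly_subst_mult: "poly_subst f (p * q) = poly_subst f p * poly_subst f q"
proof (induction p rule: poly_sum_induct)
  case (single m c)
  show ?case
  proof (induction q rule: poly_sum_induct)
    case (single m' c')
    show ?case
      by (simp add: mult_single poly_subst_single mon_subst_add Const_mult mult_ac)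
  qed (simp_all add: distrib_left poly_subst_add)
qed (simp_all add: distrib_right poly_subst_add)

lemma mon_subst_0 [simp]: "mon_subst f 0 = 1"
  by (simp add: mon_subst_def)

lemma poly_subst_Const [simp]: "poly_subst f (Const c) = Const c"
  using poly_subst_single[of f 0 c] by (simp add: Const_def)

lemma poly_subst_1 [simp]: "poly_subst f 1 = 1"
  using poly_subst_Const[of f 1] by simp

lemma poly_subst_Var [simp]: "poly_subst f (Var i) = f i"
  by (simp add: Var_def poly_subst_single mon_subst_def)

lemma poly_subst_uminus: "poly_subst f (- p) = - poly_subst f p"
  using poly_subst_add[of f p "- p"] by (simp add: eq_neg_iff_add_eq_0 add.commute)

lemma poly_subst_diff: "poly_subst f (p - q) = poly_subst f p - poly_subst f q"
  using poly_subst_add[of f p "- q"] by (simp add: poly_subst_uminus)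

lemma poly_subst_power: "poly_subst f (p ^ e) = poly_subst f p ^ e"
  by (induction e) (auto simp: poly_subst_mult)

lemma poly_subst_prod: "poly_subst f (\<Prod>i \<in> S. g i) = (\<Prod>i \<in> S. poly_subst f (g i))"
  by (induction S rule: infinite_finite_induct) (auto simp: poly_subst_mult)

lemma poly_subst_poly_subst:
  "poly_subst f (poly_subst g p) = poly_subst (\<lambda>i. poly_subst f (g i)) p"
proof (induction p rule: poly_sum_induct)
  case (single m c)
  show ?case
    by (simp add: poly_subst_single poly_subst_mult mon_subst_def poly_subst_prod poly_subst_power)
qed (simp_all add: poly_subst_add)

lemma Var_power: "Var i ^ e = Poly_Mapping.single (Poly_Mapping.single i e) (1 :: 'k::comm_ring_1)"
  by (induction e) (auto simp: Var_def mult_single single_add[symmetric])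

lemma prod_single:
  "(\<Prod>i \<in> S. Poly_Mapping.single (h i) (1 :: 'k::comm_ring_1)) = Poly_Mapping.single (\<Sum>i \<in> S. h i :: nat \<Rightarrow>\<^sub>0 nat) 1"
  by (induction S rule: infinite_finite_induct) (auto simp: mult_single)

lemma mon_subst_Var: "mon_subst Var m = Poly_Mapping.single m (1 :: 'k::comm_ring_1)"
  using poly_decomp[of m] by (simp add: mon_subst_def Var_power prod_single)

lemma poly_subst_Var_id: "poly_subst Var p = (p :: 'k::comm_ring_1 mpoly)"
proof (induction p rule: poly_sum_induct)
  case (single m c)
  show ?case
    by (simp add: poly_subst_single mon_subst_Var Const_def mult_single)
qed (simp_all add: poly_subst_add)

lemma poly_ring_Const [simp]: "Const c \<in> poly_ring n"
  by (simp add: poly_ring_def Const_def)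

lemma poly_ring_0 [simp]: "0 \<in> poly_ring n"
  by (simp add: poly_ring_def)

lemma poly_ring_1 [simp]: "(1 :: 'k::comm_ring_1 mpoly) \<in> poly_ring n"
  using poly_ring_Const[of "1 :: 'k" n] by simp

lemma poly_ring_Var: "i \<in> {1..n} \<Longrightarrow> Var i \<in> poly_ring n"
  by (simp add: poly_ring_def Var_def)

lemma poly_ring_add: "p \<in> poly_ring n \<Longrightarrow> q \<in> poly_ring n \<Longrightarrow> p + q \<in> poly_ring n"
  using keys_add[of p q] by (fastforce simp: poly_ring_def)

lemma poly_ring_mult:
  assumes "p \<in> poly_ring n" "q \<in> poly_ring n"
  shows "p * q \<in> poly_ring n"
  unfolding poly_ring_def
proof clarify
  fix m i
  assume "m \<in> Poly_Mapping.keys (p * q)" and i: "i \<in> Poly_Mapping.keys m"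
  then obtain a b where "m = a + b" "a \<in> Poly_Mapping.keys p" "b \<in> Poly_Mapping.keys q"
    using keys_mult[of p q] by auto
  with i assms keys_add[of a b] show "i \<in> {1..n}"
    unfolding poly_ring_def by blast
qed

lemma poly_ring_diff:
  "p \<in> poly_ring n \<Longrightarrow> q \<in> poly_ring n \<Longrightarrow> p - q \<in> poly_ring n"
  for p q :: "'k::comm_ring_1 mpoly"
proof -
  assume "p \<in> poly_ring n" "q \<in> poly_ring n"
  then have "p + Const (-1) * q \<in> poly_ring n"
    by (intro poly_ring_add poly_ring_mult poly_ring_Const)
  then show ?thesis
    by (simp add: Const_def single_uminus)
qed

lemma poly_ring_power: "p \<in> poly_ring n \<Longrightarrow> p ^ e \<in> poly_ring n"
  for p :: "'k::comm_ring_1 mpoly"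
  by (induction e) (auto intro: poly_ring_mult)

lemma poly_ring_subst:
  assumes "\<And>i. i \<in> {1..n} \<Longrightarrow> f i \<in> poly_ring n" "p \<in> poly_ring n"
  shows "poly_subst f p \<in> poly_ring n"
proof -
  have prod: "(\<Prod>i \<in> S. g i) \<in> poly_ring n" if "\<And>i. i \<in> S \<Longrightarrow> g i \<in> poly_ring n"
    for S :: "nat set" and g :: "nat \<Rightarrow> 'a mpoly"
    using that by (induction S rule: infinite_finite_induct) (auto intro: poly_ring_mult)
  have sum: "(\<Sum>m \<in> S. g m) \<in> poly_ring n" if "\<And>m. m \<in> S \<Longrightarrow> g m \<in> poly_ring n"
    for S :: "(nat \<Rightarrow>\<^sub>0 nat) set" and g :: "(nat \<Rightarrow>\<^sub>0 nat) \<Rightarrow> 'a mpoly"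
    using that by (induction S rule: infinite_finite_induct) (auto intro: poly_ring_add)
  show ?thesis
    unfolding poly_subst_def mon_subst_def
    by (intro sum poly_ring_mult prod poly_ring_power poly_ring_Const assms(1))
       (use assms(2) in \<open>unfold poly_ring_def, blast\<close>)
qed

fun shift_inv :: "nat \<Rightarrow> 'k::comm_ring_1 mpoly" where
  "shift_inv 0 = Var 0"
| "shift_inv (Suc 0) = Var 1 + 1"
| "shift_inv (Suc (Suc i)) = Var (Suc (Suc i)) - shift_inv (Suc i)"

theorem shift_automorphism_exists:
  "\<exists>\<sigma> :: 'k::comm_ring_1 mpoly \<Rightarrow> 'k mpoly. alg_automorphism n \<sigma> \<and> \<sigma> (Var 1) = Var 1 - 1 \<and>
     (\<forall>i \<in> {2..n}. \<sigma> (Var i) = Var i + Var (i - 1))"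
proof -
  define f :: "nat \<Rightarrow> 'k mpoly" where
    "f i = (if i = 0 then Var 0 else if i = 1 then Var 1 - 1 else Var i + Var (i - 1))" for i
  have fg: "poly_subst f (shift_inv i) = Var i" for i
    by (induction i rule: shift_inv.induct) (auto simp: f_def poly_subst_add poly_subst_diff)
  have gf: "poly_subst shift_inv (f i) = Var i" for i
    by (cases i rule: shift_inv.cases) (auto simp: f_def poly_subst_add poly_subst_diff)
  have f: "f i \<in> poly_ring n" if "i \<in> {1..n}" for i
    using that by (auto simp: f_def intro!: poly_ring_add poly_ring_diff poly_ring_Var)
  have g: "shift_inv i \<in> (poly_ring n :: 'k mpoly set)" if "i \<in> {1..n}" for i
    using that
    by (induction i rule: shift_inv.induct)
       (auto intro!: poly_ring_add poly_ring_diff poly_ring_Var)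
  have "bij_betw (poly_subst f) (poly_ring n) (poly_ring n)"
    by (rule bij_betw_byWitness[where f' = "poly_subst shift_inv"])
       (auto simp: poly_subst_poly_subst fg gf poly_subst_Var_id intro: poly_ring_subst f g)
  then have "alg_automorphism n (poly_subst f)"
    by (simp add: alg_automorphism_def poly_subst_add poly_subst_mult)
  then show ?thesis
    by (intro exI[of _ "poly_subst f"]) (auto simp: f_def)
qed

end

theory Submission
  imports Defs
begin

text \<open>
  Put $x_0 = -1$ and $x_{-1} = 0$, so that $\sigma(x_i) = x_i + x_{i-1}$ for all $i \ge 0$. Since
  $\mu_i^k = -\lambda_{0,i}^k$ and $\beta_j^k = -\alpha_{0,j}^k$, the linear parts of $u_k$ and
  $v_k$ become the rows $i = 0$ of the double sums. With
  $y_{a,j} = \sum_b \binom{a}{b} x_{j+b}$ one has $\sigma(y_{a,j}) = y_{a+1,j-1}$, and the rows of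
  the double sums are combinations of the $y_{a,j}$. Applying $\sigma - 1$, the sums over $i$
  telescope: $u_k$ is invariant, and $\sigma - 1$ maps $v_k - x_1 u_k$ to $u_k$, while
  $(\sigma - 1)(x_1 u_k) = -u_k$.
\<close>

section \<open>Binomial coefficients\<close>

lemma binom_nonneg: "binom a b \<ge> 0"
  by (simp add: binom_def)

lemma binom_pos: "0 \<le> b \<Longrightarrow> b \<le> a \<Longrightarrow> binom a b > 0"
  by (simp add: binom_def zero_less_binomial)

text \<open>Pascal's rule survives the zero convention for every integer \<open>b\<close>, but fails
  at \<open>a = b = 0\<close>, where both right-hand terms are zero.\<close>

lemma binom_pascal:
  assumes "a \<ge> 1"
  shows "binom a b = binom (a - 1) b + binom (a - 1) (b - 1)"
proof (cases "b \<ge> 1")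
  case True
  obtain a' where a: "a = int (Suc a')"
    using zero_le_imp_eq_int[of "a - 1"] assms by (auto simp: algebra_simps)
  obtain b' where b: "b = int (Suc b')"
    using zero_le_imp_eq_int[of "b - 1"] True by (auto simp: algebra_simps)
  show ?thesis
    by (auto simp: a b binom_def nat_add_distrib binomial_eq_0)
next
  case False
  then show ?thesis
    using assms by (cases "b = 0") (auto simp: binom_def)
qed

text \<open>With \<open>k + i\<close> in the exponent, the sign flips from row \<open>i\<close> to
  row \<open>Suc i\<close> without any truncated subtraction.\<close>

lemma neg_one_power_diff: "i \<le> k \<Longrightarrow> (-1 :: 'a::ring_1) ^ (k - i) = (-1) ^ (k + i)"
  by (auto simp: minus_one_power_iff even_diff_nat)

lemma mu_eq_lam: "k \<ge> 1 \<Longrightarrow> mu k i = - lam k 0 i"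
  by (cases k) (auto simp: mu_def lam_def)

text \<open>Pascal's rule reduces both sides to binomials with upper index \<open>k - 2\<close> and
  lower index \<open>c\<close>, \<open>c - 1\<close> or \<open>c - 2\<close>. Its use at upper index
  \<open>k - 1\<close> is where \<open>k \<ge> 2\<close> enters.\<close>

lemma beta_eq_alpha:
  assumes "k \<ge> 2" "j \<ge> 1"
  shows "beta k j = - alpha k 0 j"
proof -
  obtain k' where k: "k = Suc (Suc k')"
    using assms(1) by (metis add_2_eq_Suc le_Suc_ex)
  define c where "c = int j - int k - 1"
  have p1: "binom (int k) c = binom (int k - 1) c + binom (int k - 1) (c - 1)"
    "binom (int k) (c - 1) = binom (int k - 1) (c - 1) + binom (int k - 1) (c - 2)"
    using binom_pascal[of "int k" c] binom_pascal[of "int k" "c - 1"] assms by auto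
  have p2: "binom (int k - 1) c = binom (int k - 2) c + binom (int k - 2) (c - 1)"
    "binom (int k - 1) (c - 1) = binom (int k - 2) (c - 1) + binom (int k - 2) (c - 2)"
    using binom_pascal[of "int k - 1" c] binom_pascal[of "int k - 1" "c - 1"] assms by auto
  have c: "int j - int k - 1 = c" "int j - int k - 2 = c - 1"
    "int (j - 1) - int k = c" "int (j - 1) - int k - 1 = c - 1" "int (j - 1) - int k - 2 = c - 2"
    using assms by (auto simp: c_def)
  have s: "(-1 :: int) ^ k = - ((-1) ^ (k - 1))"
    by (simp add: k)
  have i: "int k - int 1 - 1 = int k - 2" "int k - int 1 = int k - 1" "int k - int 0 = int k"
    by auto
  show ?thesis
    unfolding beta_def alpha_def mu_def c i diff_zero minus_nat.diff_0 s
    by (simp add: p1 p2 algebra_simps)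
qed

lemma alpha_nonzero:
  assumes "i < k" "j \<in> {k + 1..2 * k - i + 1}"
  shows "alpha k i j \<noteq> 0"
proof -
  let ?B = "binom (int k - int i - 1)"
  \<comment> \<open>At the right end of the range the first binomial is zero by convention, while
    the second has equal indices.\<close>
  have "?B (int j - int k - 1) > 0 \<or> ?B (int j - int k - 2) > 0"
    using assms by (cases "j = 2 * k - i + 1") (auto intro!: binom_pos)
  moreover have "(int k - int i - 1) *
      (binom (int k - int i) (int j - int k - 1) + ?B (int j - int k - 2)) \<ge> 0"
    using assms by (intro mult_nonneg_nonneg add_nonneg_nonneg binom_nonneg) auto
  moreover have "?B (int j - int k - 1) \<ge> 0" "?B (int j - int k - 2) \<ge> 0"
    by (rule binom_nonneg)+
  ultimately show ?thesis
    unfolding alpha_def by auto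
qed

lemma beta_nonzero:
  assumes "k \<ge> 2" "j \<in> {k + 1..2 * k + 1}"
  shows "beta k j \<noteq> 0"
  using assms alpha_nonzero[of 0 k j] by (simp add: beta_eq_alpha)

lemma alpha_eq_lam:
  assumes "j \<ge> 1"
  shows "alpha k i j = (-1) ^ (k - i) *
      (2 * binom (int k - int i - 1) (int j - int k - 1)
       + 3 * binom (int k - int i - 1) (int j - int k - 2))
    + (int k - int i - 1) * lam k i (j - 1)"
proof -
  have c: "int (j - 1) - int k = int j - int k - 1" "int j - int k - 1 - 1 = int j - int k - 2"
    using assms by auto
  show ?thesis
    unfolding alpha_def lam_def c by (simp add: algebra_simps)
qed

section \<open>The telescoping argument\<close>

text \<open>This is \<open>y_{a,j}\<close>, given by Pascal's recursion so that its image under the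
  shift follows by induction on \<open>a\<close>.\<close>

primrec pascal_sum :: "(nat \<Rightarrow> 'r::comm_ring_1) \<Rightarrow> nat \<Rightarrow> nat \<Rightarrow> 'r" where
  "pascal_sum X 0 j = X j"
| "pascal_sum X (Suc a) j = pascal_sum X a j + pascal_sum X a (Suc j)"

text \<open>Terms outside \<open>{j..j + a}\<close> vanish by the zero convention. Allowing a larger
  \<open>S\<close> lets sums with different supports share one range.\<close>

lemma sum_binom_eq_pascal_sum:
  assumes "finite S" "{j..j + a} \<subseteq> S"
  shows "(\<Sum>l\<in>S. of_int (binom (int a) (int l - int j)) * X l) = pascal_sum X a j"
  using assms(2)
proof (induction a arbitrary: j)
  case 0
  have "(\<Sum>l\<in>S. of_int (binom (int 0) (int l - int j)) * X l) = (\<Sum>l\<in>S. if l = j then X l else 0)"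
    by (rule sum.cong) (auto simp: binom_def)
  with 0 assms(1) show ?case
    by simp
next
  case (Suc a)
  have "binom (int (Suc a)) (int l - int j)
      = binom (int a) (int l - int j) + binom (int a) (int l - int (Suc j))" for l
    using binom_pascal[of "int (Suc a)" "int l - int j"] by (simp add: algebra_simps)
  moreover have "{j..j + a} \<subseteq> S" "{Suc j..Suc j + a} \<subseteq> S"
    using Suc.prems by auto
  ultimately show ?case
    using Suc.IH[of j] Suc.IH[of "Suc j"] by (simp add: distrib_right sum.distrib)
qed

section \<open>Rows of the double sums\<close>

definition lam_row :: "(nat \<Rightarrow> 'r::comm_ring_1) \<Rightarrow> nat \<Rightarrow> nat \<Rightarrow> 'r" where
  "lam_row X k a = pascal_sum X a k + pascal_sum X (a - 1) (k + 1)"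

definition alpha_row :: "(nat \<Rightarrow> 'r::comm_ring_1) \<Rightarrow> nat \<Rightarrow> nat \<Rightarrow> 'r" where
  "alpha_row X k a = 2 * pascal_sum X (a - 1) (k + 1) + 3 * pascal_sum X (a - 1) (k + 2)
     + (of_nat a - 1) * (pascal_sum X a (k + 1) + pascal_sum X (a - 1) (k + 2))"

text \<open>The range of \<open>j\<close> contains the supports of both binomials. Since
  \<open>i < k\<close>, the subtraction of 1 inside \<open>lam_row\<close> does not
  truncate.\<close>

lemma sum_lam_eq_lam_row:
  assumes "i < k"
  shows "(\<Sum>j = k..2 * k - i. of_int (lam k i j) * X j) = (-1) ^ (k + i) * lam_row X k (k - i)"
proof -
  obtain a where a: "k - i = Suc a"
    using assms by (metis Suc_diff_Suc)
  let ?S = "{k..2 * k - i}"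
  define f where "f b c j = (of_int (binom (int b) (int j - int c)) :: 'a)" for b c j
  have row: "(\<Sum>j\<in>?S. f b c j * X j) = pascal_sum X b c" if "k \<le> c" "c + b \<le> k + a + 1" for b c
    unfolding f_def using that a by (intro sum_binom_eq_pascal_sum) force+
  have "of_int (lam k i j) = (-1) ^ (k + i) * (f (Suc a) k j + f a (k + 1) j)" for j
  proof -
    have "int k - int i = int (Suc a)" "int (Suc a) - 1 = int a"
      "int j - int k - 1 = int j - int (k + 1)"
      using a by auto
    then show ?thesis
      using assms unfolding lam_def f_def by (simp only: neg_one_power_diff) simp
  qed
  then have "(\<Sum>j\<in>?S. of_int (lam k i j) * X j) = (-1) ^ (k + i) *
      ((\<Sum>j\<in>?S. f (Suc a) k j * X j) + (\<Sum>j\<in>?S. f a (k + 1) j * X j))"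
    by (simp only: sum_distrib_left flip: sum.distrib) (simp only: algebra_simps)
  also have "\<dots> = (-1) ^ (k + i) * lam_row X k (Suc a)"
    by (simp add: row lam_row_def del: pascal_sum.simps)
  finally show ?thesis
    by (simp only: a)
qed

lemma sum_alpha_eq_alpha_row:
  assumes "i < k"
  shows "(\<Sum>j = k + 1..2 * k - i + 1. of_int (alpha k i j) * X j)
    = (-1) ^ (k + i) * alpha_row X k (k - i)"
proof -
  obtain a where a: "k - i = Suc a"
    using assms by (metis Suc_diff_Suc)
  let ?S = "{k + 1..2 * k - i + 1}"
  define f where "f b c j = (of_int (binom (int b) (int j - int c)) :: 'a)" for b c j
  have row: "(\<Sum>j\<in>?S. f b c j * X j) = pascal_sum X b c" if "k + 1 \<le> c" "c + b \<le> k + a + 2" for b c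
    unfolding f_def using that a by (intro sum_binom_eq_pascal_sum) force+
  have "of_int (alpha k i j) = (-1) ^ (k + i) * (2 * f a (k + 1) j + 3 * f a (k + 2) j
      + of_nat a * (f (Suc a) (k + 1) j + f a (k + 2) j))" for j
  proof -
    have "int k - int i = int (Suc a)" "int (Suc a) - 1 = int a"
      "int j - int k - 1 = int j - int (k + 1)" "int j - int k - 2 = int j - int (k + 2)"
      using a by auto
    then show ?thesis
      using assms unfolding alpha_def f_def by (simp only: neg_one_power_diff) simp
  qed
  then have "(\<Sum>j\<in>?S. of_int (alpha k i j) * X j) = (-1) ^ (k + i) *
      (2 * (\<Sum>j\<in>?S. f a (k + 1) j * X j) + 3 * (\<Sum>j\<in>?S. f a (k + 2) j * X j)
       + of_nat a * ((\<Sum>j\<in>?S. f (Suc a) (k + 1) j * X j) + (\<Sum>j\<in>?S. f a (k + 2) j * X j)))"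
    by (simp only: sum_distrib_left flip: sum.distrib) (simp only: algebra_simps)
  also have "\<dots> = (-1) ^ (k + i) * alpha_row X k (Suc a)"
    by (subst (1 2 3 4) row) (simp_all add: alpha_row_def)
  finally show ?thesis
    by (simp only: a)
qed

text \<open>In an abstract ring \<open>X 0\<close> may be a constant, which merges the two rules
  defining the automorphism. It stays an arbitrary fixed element until \<open>V_invariant\<close>
  sets it to \<open>-1\<close>.\<close>

locale unipotent_shift =
  fixes s :: "'r::comm_ring_1 \<Rightarrow> 'r" and X :: "nat \<Rightarrow> 'r"
  assumes add: "s (p + q) = s p + s q"
    and mult: "s (p * q) = s p * s q"
    and one: "s 1 = 1"
    and X_0: "s (X 0) = X 0"
    and X_Suc: "s (X (Suc i)) = X (Suc i) + X i"
begin

lemma zero: "s 0 = 0"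
  using add[of 0 0] by simp

lemma uminus: "s (- p) = - s p"
  using add[of p "- p"] by (simp add: zero eq_neg_iff_add_eq_0 add.commute)

lemma diff: "s (p - q) = s p - s q"
  using add[of p "- q"] by (simp add: uminus)

lemma of_nat: "s (of_nat m) = of_nat m"
  by (induction m) (simp_all add: zero add one)

lemma numeral: "s (numeral m) = numeral m"
  using of_nat[of "numeral m"] by simp

lemma neg_one_power: "s ((-1) ^ m) = (-1) ^ m"
  by (induction m) (simp_all add: one mult uminus)

lemmas hom_simps = add mult one zero uminus diff of_nat numeral neg_one_power

text \<open>Each \<open>X (Suc l)\<close> gains its predecessor, so \<open>y_{a,j+1}\<close> gains
  \<open>y_{a,j}\<close>; the sum of the two is Pascal's recursion.\<close>

lemma pascal_sum: "s (pascal_sum X a (Suc j)) = pascal_sum X (Suc a) j"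
  by (induction a arbitrary: j) (simp_all add: X_Suc add algebra_simps)

text \<open>
  The value \<open>R' (Suc m)\<close> is free: below it is given by the formula for \<open>R'\<close> although the row
  \<open>R (Suc m)\<close> would involve $y_{-1,j}$.
\<close>

lemma telescope:
  assumes "\<And>i. i \<le> m \<Longrightarrow> s (R i) = R' i"
  shows "s (\<Sum>i\<le>m. (-1) ^ (k + i) * X i * R i) - (\<Sum>i\<le>m. (-1) ^ (k + i) * X i * R i)
    = (\<Sum>i\<le>m. (-1) ^ (k + i) * X i * (R' i - R i - R' (Suc i)))
      + (-1) ^ (k + m) * X m * R' (Suc m)"
  using assms
proof (induction m)
  case 0
  then show ?case
    by (simp add: hom_simps X_0 algebra_simps)
next
  case (Suc m)
  have "s (\<Sum>i\<le>m. (-1) ^ (k + i) * X i * R i) = (\<Sum>i\<le>m. (-1) ^ (k + i) * X i * R i)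
     + (\<Sum>i\<le>m. (-1) ^ (k + i) * X i * (R' i - R i - R' (Suc i)))
      + (-1) ^ (k + m) * X m * R' (Suc m)"
    using Suc by (simp add: algebra_simps)
  \<comment> \<open>Shifting \<open>X (Suc m)\<close> produces \<open>X m * R' (Suc m)\<close> with
    the opposite sign, which cancels the boundary term of the induction hypothesis.\<close>
  with Suc.prems[of "Suc m"] show ?case
    by (simp add: hom_simps X_Suc algebra_simps)
qed

section \<open>Invariance of the abstract counterparts of \<open>u\<close> and
  \<open>v\<close>\<close>

definition U :: "nat \<Rightarrow> 'r" where
  "U k = X k ^ 2 + (\<Sum>i<k. (-1) ^ (k + i) * X i * lam_row X k (k - i))"

definition V :: "nat \<Rightarrow> 'r" where
  "V k = X 1 * U k + X k * X (k + 1) + (\<Sum>i<k. (-1) ^ (k + i) * X i * alpha_row X k (k - i))"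

text \<open>All telescoped coefficients vanish by Pascal's rule. With \<open>m = k - 1\<close> the
  boundary term is \<open>- X m * (X m + 2 * X k)\<close>, which cancels the change of
  \<open>X k ^ 2\<close>.\<close>

lemma U_invariant:
  assumes "k \<ge> 1"
  shows "s (U k) = U k"
proof -
  obtain m where k: "k = Suc m"
    using assms by (cases k) auto
  \<comment> \<open>The shift raises the first index of each \<open>y\<close> and lowers the second.
    The resulting formula still makes sense at \<open>i = k\<close>, where it gives the boundary
    value.\<close>
  define R' where "R' i = pascal_sum X (Suc (k - i)) m + pascal_sum X (k - i) k" for i
  have R': "s (lam_row X k (k - i)) = R' i" if "i \<le> m" for i
  proof -
    obtain a where "k - i = Suc a"
      using \<open>i \<le> m\<close> k by (metis Suc_diff_le)
    then show ?thesis
      using pascal_sum[of "Suc a" m] pascal_sum[of a k]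
      by (simp add: lam_row_def R'_def add k del: pascal_sum.simps)
  qed
  have zero_coeff: "R' i - lam_row X k (k - i) - R' (Suc i) = 0" if "i \<le> m" for i
  proof -
    obtain a where "k - i = Suc a" "k - Suc i = a"
      using \<open>i \<le> m\<close> k by (metis Suc_diff_le diff_Suc_Suc)
    then show ?thesis
      unfolding R'_def lam_row_def by (simp add: k)
  qed
  have "s (\<Sum>i\<le>m. (-1) ^ (k + i) * X i * lam_row X k (k - i))
      = (\<Sum>i\<le>m. (-1) ^ (k + i) * X i * lam_row X k (k - i)) + (-1) ^ (k + m) * X m * R' (Suc m)"
    using telescope[of m "\<lambda>i. lam_row X k (k - i)" R' k] R' zero_coeff
    by (simp add: algebra_simps)
  then show ?thesis
    unfolding U_def lessThan_Suc_atMost k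
    by (simp add: R'_def k hom_simps X_Suc power2_eq_square algebra_simps)
qed

text \<open>The telescoped coefficients are now the rows of \<open>U k\<close>; the change of
  \<open>X k * X (k + 1)\<close> supplies the missing square and cancels the boundary term. The
  total gain \<open>U k\<close> is taken back by \<open>X 1 * U k\<close>.\<close>

lemma V_invariant:
  assumes "k \<ge> 1" "X 0 = -1"
  shows "s (V k) = V k"
proof -
  obtain m where k: "k = Suc m"
    using assms by (cases k) auto
  define R' where "R' i = 2 * pascal_sum X (k - i) k + 3 * pascal_sum X (k - i) (k + 1)
     + (of_nat (k - i) - 1) * (pascal_sum X (Suc (k - i)) k + pascal_sum X (k - i) (k + 1))" for i
  have R': "s (alpha_row X k (k - i)) = R' i" if "i \<le> m" for i
  proof -
    obtain a where "k - i = Suc a"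
      using \<open>i \<le> m\<close> k by (metis Suc_diff_le)
    then show ?thesis
      using pascal_sum[of "Suc a" k] pascal_sum[of a k] pascal_sum[of a "k + 1"]
      by (simp add: alpha_row_def R'_def hom_simps del: pascal_sum.simps)
  qed
  have coeff: "R' i - alpha_row X k (k - i) - R' (Suc i) = lam_row X k (k - i)" if "i \<le> m" for i
  proof -
    obtain a where "k - i = Suc a" "k - Suc i = a"
      using \<open>i \<le> m\<close> k by (metis Suc_diff_le diff_Suc_Suc)
    then show ?thesis
      unfolding R'_def lam_row_def alpha_row_def by (simp add: algebra_simps)
  qed
  have "s (\<Sum>i\<le>m. (-1) ^ (k + i) * X i * alpha_row X k (k - i))
      = (\<Sum>i\<le>m. (-1) ^ (k + i) * X i * alpha_row X k (k - i))
        + (\<Sum>i\<le>m. (-1) ^ (k + i) * X i * lam_row X k (k - i))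
        + (-1) ^ (k + m) * X m * R' (Suc m)"
    using telescope[of m "\<lambda>i. alpha_row X k (k - i)" R' k] R' coeff
    by (simp add: algebra_simps)
  \<comment> \<open>Here \<open>k - i\<close> is 0, so the ring factor \<open>of_nat 0 - 1\<close>
    is \<open>-1\<close> and lowers the coefficients 2 and 3 to 1 each.\<close>
  moreover have "(-1) ^ (k + m) * X m * R' (Suc m) = - X m * (X k + X (k + 1))"
    by (simp add: R'_def k algebra_simps)
  moreover have "(\<Sum>i\<le>m. (-1) ^ (k + i) * X i * lam_row X k (k - i)) = U k - X k ^ 2"
    by (simp add: U_def k lessThan_Suc_atMost)
  ultimately have "s (\<Sum>i<k. (-1) ^ (k + i) * X i * alpha_row X k (k - i))
      = (\<Sum>i<k. (-1) ^ (k + i) * X i * alpha_row X k (k - i))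
        + (U k - X k ^ 2) - X m * (X k + X (k + 1))"
    by (simp add: k lessThan_Suc_atMost)
  moreover have "s (X 1) = X 1 - 1" "s (X k) = X k + X m" "s (X (k + 1)) = X (k + 1) + X k"
    using X_Suc[of 0] X_Suc[of m] X_Suc[of k] assms(2) k by auto
  ultimately show ?thesis
    using U_invariant[OF assms(1)]
    by (simp only: V_def add mult) (simp add: power2_eq_square algebra_simps)
qed

end

section \<open>Polynomials of bounded degree\<close>

lemma mon_degree_superset:
  assumes "finite S" "Poly_Mapping.keys m \<subseteq> S"
  shows "mon_degree m = (\<Sum>i\<in>S. Poly_Mapping.lookup m i)"
  unfolding mon_degree_def
  by (rule sum.mono_neutral_left) (use assms in \<open>auto simp: in_keys_iff\<close>)

lemma mon_degree_add: "mon_degree (m + m') = mon_degree m + mon_degree m'"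
proof -
  let ?S = "Poly_Mapping.keys m \<union> Poly_Mapping.keys m'"
  have "Poly_Mapping.keys (m + m') \<subseteq> ?S"
    by (rule keys_add)
  then show ?thesis
    by (subst (1 2 3) mon_degree_superset[of ?S]) (auto simp: lookup_add sum.distrib)
qed

lemma polys_le_mono: "p \<in> polys_le n d \<Longrightarrow> d \<le> e \<Longrightarrow> p \<in> polys_le n e"
  by (force simp: polys_le_def)

lemma polys_le_Const: "Const c \<in> polys_le n d"
  by (auto simp: polys_le_def) (auto simp: Const_def mon_degree_def split: if_splits)

lemma polys_le_Var: "i \<in> {1..n} \<Longrightarrow> d \<ge> 1 \<Longrightarrow> Var i \<in> polys_le n d"
  by (auto simp: polys_le_def poly_ring_Var) (auto simp: Var_def mon_degree_def)

lemma polys_le_add: "p \<in> polys_le n d \<Longrightarrow> q \<in> polys_le n d \<Longrightarrow> p + q \<in> polys_le n d"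
  using keys_add[of p q] by (fastforce simp: polys_le_def intro: poly_ring_add)

lemma polys_le_mult:
  assumes "p \<in> polys_le n d" "q \<in> polys_le n e"
  shows "p * q \<in> polys_le n (d + e)"
proof -
  have "mon_degree m \<le> d + e" if m: "m \<in> Poly_Mapping.keys (p * q)" for m
  proof -
    obtain a b where "m = a + b" "a \<in> Poly_Mapping.keys p" "b \<in> Poly_Mapping.keys q"
      using m keys_mult[of p q] by auto
    with assms show ?thesis
      by (simp add: polys_le_def mon_degree_add add_mono)
  qed
  with assms show ?thesis
    by (simp add: polys_le_def poly_ring_mult)
qed

lemma polys_le_sum: "(\<And>i. i \<in> S \<Longrightarrow> g i \<in> polys_le n d) \<Longrightarrow> (\<Sum>i\<in>S. g i) \<in> polys_le n d"
  by (induction S rule: infinite_finite_induct)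
     (auto intro: polys_le_add simp: polys_le_Const[of 0, simplified])

lemma polys_le_linear_term:
  "i \<in> {1..n} \<Longrightarrow> Const (c :: 'k::comm_ring_1) * Var i \<in> polys_le n 1"
  using polys_le_mult[OF polys_le_Const[of c n 0] polys_le_Var[of i n 1]] by simp

lemma polys_le_quadratic_term:
  "i \<in> {1..n} \<Longrightarrow> j \<in> {1..n} \<Longrightarrow> Const (c :: 'k::comm_ring_1) * Var i * Var j \<in> polys_le n 2"
  using polys_le_mult[OF polys_le_linear_term[of i n c] polys_le_Var[of j n 1]]
  by (simp add: numeral_2_eq_2)

lemma u_polys_le:
  assumes "k \<ge> 1" "2 * k \<le> n"
  shows "(u k :: 'k::comm_ring_1 mpoly) \<in> polys_le n 2"
proof -
  have "(Var k :: 'k mpoly) ^ 2 \<in> polys_le n 2"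
    using polys_le_quadratic_term[of k n k "1 :: 'k"] assms by (simp add: power2_eq_square)
  moreover have "Const c * Var i \<in> polys_le n 2" if "i \<in> {k..2 * k}" for c :: 'k and i
    using that assms by (intro polys_le_mono[OF polys_le_linear_term[of i n c]]) auto
  ultimately show ?thesis
    unfolding u_def using assms
    by (intro polys_le_add polys_le_sum polys_le_quadratic_term) auto
qed

text \<open>Degree 3 comes only from \<open>Var 1 * u k\<close>, and the largest index
  \<open>2 * k + 1\<close> from the linear sum.\<close>

lemma v_polys_le:
  assumes "k \<ge> 1" "2 * k + 1 \<le> n"
  shows "(v k :: 'k::comm_ring_1 mpoly) \<in> polys_le n 3"
proof -
  have quadratic: "Const c * Var i * Var j \<in> polys_le n 3"
    if "i \<in> {1..n}" "j \<in> {1..n}" for c :: 'k and i j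
    using that by (intro polys_le_mono[OF polys_le_quadratic_term[of i n j c]]) auto
  have linear: "Const c * Var i \<in> polys_le n 3" if "i \<in> {1..n}" for c :: 'k and i
    using that by (intro polys_le_mono[OF polys_le_linear_term[of i n c]]) auto
  have "(Var 1 * u k :: 'k mpoly) \<in> polys_le n 3"
    using polys_le_mult[OF polys_le_Var u_polys_le, of 1 n 1 k] assms by (simp add: numeral_3_eq_3)
  moreover have "(Var k * Var (k + 1) :: 'k mpoly) \<in> polys_le n 3"
    using quadratic[of k "k + 1" 1] assms by simp
  ultimately show ?thesis
    unfolding v_def using assms
    by (intro polys_le_add polys_le_sum quadratic linear) auto
qed

section \<open>Invariance of the polynomials\<close>

text \<open>This trades \<sigma>, whose laws hold only on \<open>poly_ring n\<close>, for a
  substitution that is a homomorphism on the whole type, as the locale requires.\<close>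

lemma alg_automorphism_eq_poly_subst:
  fixes \<sigma> :: "'k::comm_ring_1 mpoly \<Rightarrow> 'k mpoly"
  assumes \<sigma>: "alg_automorphism n \<sigma>" and f: "\<And>i. i \<in> {1..n} \<Longrightarrow> \<sigma> (Var i) = f i"
    and p: "p \<in> poly_ring n"
  shows "\<sigma> p = poly_subst f p"
proof -
  have add: "\<sigma> (p + q) = \<sigma> p + \<sigma> q" and mult: "\<sigma> (p * q) = \<sigma> p * \<sigma> q"
    if "p \<in> poly_ring n" "q \<in> poly_ring n" for p q
    using \<sigma> that by (auto simp: alg_automorphism_def)
  have Const: "\<sigma> (Const c) = Const c" for c
    using \<sigma> by (simp add: alg_automorphism_def)
  note one = Const[of 1, simplified]
  have power: "\<sigma> (q ^ e) = \<sigma> q ^ e" if "q \<in> poly_ring n" for q e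
    by (induction e) (simp_all add: one mult that poly_ring_power)
  \<comment> \<open>Membership is carried through the induction because \<sigma> is multiplicative
    only inside \<open>poly_ring n\<close>.\<close>
  have prod: "(\<Prod>i\<in>S. g i) \<in> poly_ring n \<and> \<sigma> (\<Prod>i\<in>S. g i) = (\<Prod>i\<in>S. \<sigma> (g i))"
    if "\<And>i. i \<in> S \<Longrightarrow> g i \<in> poly_ring n" for S :: "nat set" and g
    using that by (induction S rule: infinite_finite_induct) (auto simp: one mult intro: poly_ring_mult)
  have sum: "(\<Sum>i\<in>S. g i) \<in> poly_ring n \<and> \<sigma> (\<Sum>i\<in>S. g i) = (\<Sum>i\<in>S. \<sigma> (g i))"
    if "\<And>i. i \<in> S \<Longrightarrow> g i \<in> poly_ring n" for S :: "(nat \<Rightarrow>\<^sub>0 nat) set" and g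
    using that by (induction S rule: infinite_finite_induct)
      (auto simp: Const[of 0, simplified] add intro: poly_ring_add)
  have mon: "(mon_subst Var m :: 'k mpoly) \<in> poly_ring n \<and> \<sigma> (mon_subst Var m) = mon_subst f m"
    if "m \<in> Poly_Mapping.keys p" for m
  proof -
    have m: "i \<in> {1..n}" if "i \<in> Poly_Mapping.keys m" for i
      using that \<open>m \<in> Poly_Mapping.keys p\<close> p unfolding poly_ring_def by blast
    have "\<sigma> (Var i ^ e) = f i ^ e \<and> (Var i ^ e :: 'k mpoly) \<in> poly_ring n" if "i \<in> Poly_Mapping.keys m" for i e
      using m[OF that] by (simp add: power f poly_ring_Var poly_ring_power)
    then show ?thesis
      unfolding mon_subst_def using prod[of "Poly_Mapping.keys m" "\<lambda>i. Var i ^ Poly_Mapping.lookup m i"] by simp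
  qed
  have "\<sigma> (poly_subst Var p) = poly_subst f p"
    unfolding poly_subst_def
    using sum[of "Poly_Mapping.keys p"] mon by (simp add: mult Const poly_ring_mult)
  then show ?thesis
    by (simp add: poly_subst_Var_id)
qed

section \<open>Identification of \<open>u\<close> and \<open>v\<close> with the abstract
  \<open>U\<close> and \<open>V\<close>\<close>

lemma Const_of_int: "Const (of_int c) = (of_int c :: 'k::comm_ring_1 mpoly)"
proof -
  have "Const (- a) = - Const a" for a :: 'k
    by (simp add: Const_def single_uminus)
  moreover have "Const (of_nat m) = (of_nat m :: 'k mpoly)" for m
    by (induction m) (simp_all add: Const_add)
  ultimately show ?thesis
    by (cases c) (auto simp del: of_nat_Suc)
qed

definition ext_var :: "nat \<Rightarrow> 'k::comm_ring_1 mpoly" where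
  "ext_var i = (if i = 0 then -1 else Var i)"

text \<open>The value at \<open>0\<close> is junk: \<^term>\<open>ext_var 0\<close> is the constant $-1$, not a variable.\<close>

definition ext_shift :: "nat \<Rightarrow> 'k::comm_ring_1 mpoly" where
  "ext_shift i = ext_var i + ext_var (i - 1)"

text \<open>The constant \<open>ext_var 0\<close> is fixed by every substitution, and
  \<open>X_Suc\<close> at 0 reads as subtracting 1 from \<open>Var 1\<close>.\<close>

interpretation ext: unipotent_shift "poly_subst ext_shift" ext_var
  by standard
    (simp_all add: poly_subst_add poly_subst_mult ext_var_def poly_subst_uminus ext_shift_def)

lemma sum_lessThan_eq_first_row:
  fixes g :: "nat \<Rightarrow> 'a::comm_monoid_add"
  shows "k \<ge> 1 \<Longrightarrow> (\<Sum>i<k. g i) = g 0 + (\<Sum>i = 1..k - 1. g i)"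
  by (cases k) (simp_all add: lessThan_Suc_atMost atMost_atLeast0 sum.atLeast_Suc_atMost)

lemma u_eq_U:
  assumes "k \<ge> 1"
  shows "u k = (ext.U k :: 'k::comm_ring_1 mpoly)"
proof -
  have "(\<Sum>i<k. (-1) ^ (k + i) * ext_var i * lam_row ext_var k (k - i))
     = (\<Sum>i<k. \<Sum>j = k..2 * k - i. of_int (lam k i j) * ext_var i * (ext_var j :: 'k mpoly))"
    by (rule sum.cong)
       (simp_all add: mult.commute mult.left_commute sum_lam_eq_lam_row[symmetric] sum_distrib_left)
  \<comment> \<open>Row 0 carries the factor \<open>ext_var 0 = -1\<close>, which turns
    \<open>lam k 0 j\<close> into \<open>mu k j\<close>. All other indices are positive, so
    \<open>ext_var\<close> agrees with \<open>Var\<close> there.\<close>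
  also have "\<dots> = (\<Sum>j = k..2 * k. of_int (mu k j) * Var j)
     + (\<Sum>i = 1..k - 1. \<Sum>j = k..2 * k - i. of_int (lam k i j) * Var i * Var j)"
    using assms
    by (subst sum_lessThan_eq_first_row)
       (auto simp: ext_var_def mu_eq_lam intro!: arg_cong2[of _ _ _ _ "(+)"] sum.cong)
  finally show ?thesis
    using assms by (simp add: u_def ext.U_def ext_var_def Const_of_int)
qed

lemma v_eq_V:
  assumes "k \<ge> 2"
  shows "v k = (ext.V k :: 'k::comm_ring_1 mpoly)"
proof -
  have "(\<Sum>i<k. (-1) ^ (k + i) * ext_var i * alpha_row ext_var k (k - i))
     = (\<Sum>i<k. \<Sum>j = k + 1..2 * k - i + 1. of_int (alpha k i j) * ext_var i * (ext_var j :: 'k mpoly))"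
    by (rule sum.cong)
       (simp_all add: mult.commute mult.left_commute sum_distrib_left
         sum_alpha_eq_alpha_row[symmetric] del: sum.cl_ivl_Suc)
  also have "\<dots> = (\<Sum>j = k + 1..2 * k + 1. of_int (beta k j) * Var j)
     + (\<Sum>i = 1..k - 1. \<Sum>j = k + 1..2 * k - i + 1. of_int (alpha k i j) * Var i * Var j)"
    using assms
    by (subst sum_lessThan_eq_first_row)
       (auto simp: ext_var_def beta_eq_alpha intro!: arg_cong2[of _ _ _ _ "(+)"] sum.cong)
  finally show ?thesis
    using assms by (simp add: v_def ext.V_def u_eq_U ext_var_def Const_of_int)
qed

theorem theorem1p3:
  fixes n :: nat
    and \<sigma> :: "'k::field_char_0 mpoly \<Rightarrow> 'k mpoly"
  assumes "n \<ge> 5"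
    and "alg_automorphism n \<sigma>"
    and "\<sigma> (Var 1) = Var 1 - 1"
    and "\<forall>i \<in> {2..n}. \<sigma> (Var i) = Var i + Var (i - 1)"
  shows "\<forall>k \<in> {2..(n - 1) div 2}.
      (v k :: 'k mpoly) \<in> fixed_ring n \<sigma> \<inter> polys_le n 3 \<and>
      (\<forall>i \<in> {1..k - 1}. \<forall>j \<in> {k + 1..2 * k - i + 1}.
         alpha k i j = (-1) ^ (k - i) *
             (2 * binom (int k - int i - 1) (int j - int k - 1)
              + 3 * binom (int k - int i - 1) (int j - int k - 2))
           + (int k - int i - 1) * lam k i (j - 1)) \<and>
      (\<forall>i \<in> {1..k - 1}. \<forall>j \<in> {k + 1..2 * k - i + 1}. (of_int (alpha k i j) :: 'k) \<noteq> 0) \<and>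
      (\<forall>i \<in> {k + 1..2 * k + 1}. (of_int (beta k i) :: 'k) \<noteq> 0)"
proof
  fix k assume k: "k \<in> {2..(n - 1) div 2}"
  then have le: "k \<ge> 2" "2 * k + 1 \<le> n"
    using assms(1) by auto
  have deg: "(v k :: 'k mpoly) \<in> polys_le n 3"
    using le by (intro v_polys_le) auto
  have "\<sigma> (Var i) = ext_shift i" if "i \<in> {1..n}" for i
    using that assms(3,4) by (cases "i = 1") (auto simp: ext_shift_def ext_var_def)
  then have "\<sigma> (v k) = poly_subst ext_shift (v k)"
    using deg by (intro alg_automorphism_eq_poly_subst[OF assms(2)]) (auto simp: polys_le_def)
  also have "\<dots> = v k"
    using le ext.V_invariant[of k] by (simp add: v_eq_V ext_var_def)
  finally have "(v k :: 'k mpoly) \<in> fixed_ring n \<sigma> \<inter> polys_le n 3"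
    using deg by (simp add: fixed_ring_def polys_le_def)
  then show "(v k :: 'k mpoly) \<in> fixed_ring n \<sigma> \<inter> polys_le n 3 \<and>
      (\<forall>i \<in> {1..k - 1}. \<forall>j \<in> {k + 1..2 * k - i + 1}.
         alpha k i j = (-1) ^ (k - i) *
             (2 * binom (int k - int i - 1) (int j - int k - 1)
              + 3 * binom (int k - int i - 1) (int j - int k - 2))
           + (int k - int i - 1) * lam k i (j - 1)) \<and>
      (\<forall>i \<in> {1..k - 1}. \<forall>j \<in> {k + 1..2 * k - i + 1}. (of_int (alpha k i j) :: 'k) \<noteq> 0) \<and>
      (\<forall>i \<in> {k + 1..2 * k + 1}. (of_int (beta k i) :: 'k) \<noteq> 0)"
    \<comment> \<open>Characteristic zero transfers nonvanishing from the integers to the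
      field.\<close>
    using le alpha_nonzero[of _ k] beta_nonzero[of k] by (intro conjI ballI alpha_eq_lam) auto
qed

end
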